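(* Let $f,g:2^{[n]}\to\mathbb{R}$ be set functions, identified with the elements $f=\sum_{S\subseteq[n]}f_S t^S$ and $g=\sum_{S\subseteq[n]}g_S t^S$ of $\mathcal{A}_n=\mathbb{R}[t_1,\dots,t_n]/(t_1^2,\dots,t_n^2)$. Then the additive convolution of $f$ and $g$ is their product in $\mathcal{A}_n$: $$f\boxplus g=fg \mod (t_1^2,\dots,t_n^2).$$
   Context: $[n]=\{1,\dots,n\}$; $t^S:=\prod_{i\in S}t_i$, $t^\varnothing=1$, and $\{t^S:S\subseteq[n]\}$ is a basis of $\mathcal{A}_n$. The additive convolution of set functions $f,g$ is the set function $(f\boxplus g)_S:=\sum_{A\subseteq S}f_A\,g_{S\setminus A}$, for all $S\subseteq[n]$, identified with the element $\sum_S (f\boxplus g)_S t^S$ of $\mathcal{A}_n$. *)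

theory Defs
  imports Complex_Main "HOL-Library.Poly_Mapping" "HOL-Algebra.QuotRing"
begin

text \<open>
  A polynomial is a finitely supported map from exponent vectors to coefficients. Over \<^typ>\<open>nat\<close>
  as index type of the variables, $\mathbb{R}[t_1,\dots,t_n]$ consists of those polynomials
  all of whose exponent vectors are supported on $\{1,\dots,n\}$.
\<close>

type_synonym rpoly = "(nat \<Rightarrow>\<^sub>0 nat) \<Rightarrow>\<^sub>0 real"

definition poly_ring :: "nat \<Rightarrow> rpoly ring" where
  "poly_ring n =
    \<lparr>carrier = {p. \<forall>m \<in> Poly_Mapping.keys p. Poly_Mapping.keys m \<subseteq> {1..n}},
     mult = (*), one = 1, zero = 0, add = (+)\<rparr>"

definition const :: "real \<Rightarrow> rpoly" where
  "const c = Poly_Mapping.single 0 c"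

definition var :: "nat \<Rightarrow> rpoly" where
  "var i = Poly_Mapping.single (Poly_Mapping.single i 1) 1"

definition sq_ideal :: "nat \<Rightarrow> rpoly set" where
  "sq_ideal n = genideal (poly_ring n) ((\<lambda>i. var i ^ 2) ` {1..n})"

definition algA :: "nat \<Rightarrow> rpoly set ring" where
  "algA n = poly_ring n Quot sq_ideal n"

definition tpow :: "nat set \<Rightarrow> rpoly" where
  "tpow S = (\<Prod>i\<in>S. var i)"

text \<open>
  A set function $2^{[n]} \to \mathbb{R}$ is represented by a total function on sets of naturals;
  only its values on subsets of $\{1,\dots,n\}$ are used in the element
  $\sum_{S \subseteq [n]} f_S t^S$ of $\mathcal{A}_n$.
\<close>

definition elt :: "nat \<Rightarrow> (nat set \<Rightarrow> real) \<Rightarrow> rpoly set" where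
  "elt n f = sq_ideal n +>\<^bsub>poly_ring n\<^esub> (\<Sum>S\<in>Pow {1..n}. const (f S) * tpow S)"

definition set_conv :: "(nat set \<Rightarrow> real) \<Rightarrow> (nat set \<Rightarrow> real) \<Rightarrow> nat set \<Rightarrow> real"
    (infixl \<open>\<boxplus>\<close> 65)
  where "(f \<boxplus> g) S = (\<Sum>A\<in>Pow S. f A * g (S - A))"

lemma poly_ring_simps [simp]:
  "mult (poly_ring n) = (*)" "one (poly_ring n) = 1"
  "zero (poly_ring n) = 0" "add (poly_ring n) = (+)"
  by (simp_all add: poly_ring_def)

lemma carrier_poly_ring_iff:
  "p \<in> carrier (poly_ring n) \<longleftrightarrow> (\<forall>m \<in> Poly_Mapping.keys p. Poly_Mapping.keys m \<subseteq> {1..n})"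
  by (simp add: poly_ring_def)

lemma poly_ring_cring: "cring (poly_ring n)"
proof -
  have zero: "0 \<in> carrier (poly_ring n)" and one: "1 \<in> carrier (poly_ring n)"
    by (simp_all add: carrier_poly_ring_iff)
  have add: "p + q \<in> carrier (poly_ring n)"
    if "p \<in> carrier (poly_ring n)" "q \<in> carrier (poly_ring n)" for p q
    using that Poly_Mapping.keys_add[of p q] unfolding carrier_poly_ring_iff by blast
  have mult: "p * q \<in> carrier (poly_ring n)"
    if p: "p \<in> carrier (poly_ring n)" and q: "q \<in> carrier (poly_ring n)" for p q
    unfolding carrier_poly_ring_iff
  proof
    fix m assume m: "m \<in> Poly_Mapping.keys (p * q)"
    then obtain a b where ab: "a \<in> Poly_Mapping.keys p" "b \<in> Poly_Mapping.keys q" "m = a + b"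
      using Poly_Mapping.keys_mult[of p q] by blast
    then have "Poly_Mapping.keys a \<subseteq> {1..n}" "Poly_Mapping.keys b \<subseteq> {1..n}"
      using p q unfolding carrier_poly_ring_iff by blast+
    then show "Poly_Mapping.keys m \<subseteq> {1..n}"
      using Poly_Mapping.keys_add[of a b] ab(3) by blast
  qed
  have uminus: "- p \<in> carrier (poly_ring n)" if "p \<in> carrier (poly_ring n)" for p
  proof -
    have "Poly_Mapping.keys (- p) = Poly_Mapping.keys p"
      by transfer auto
    then show ?thesis using that by (simp add: carrier_poly_ring_iff)
  qed
  have "abelian_group (poly_ring n)"
  proof (rule abelian_groupI, unfold poly_ring_simps)
    fix p assume "p \<in> carrier (poly_ring n)"
    then show "\<exists>q\<in>carrier (poly_ring n). q + p = 0"
      by (intro bexI[of _ "- p"] uminus) simp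
  qed (simp_all add: zero add add_ac)
  moreover have "Group.comm_monoid (poly_ring n)"
    by (rule comm_monoidI, unfold poly_ring_simps) (simp_all add: one mult mult_ac)
  ultimately show ?thesis
    by (rule cringI) (simp add: distrib_right)
qed

lemma var_carrier: "i \<in> {1..n} \<Longrightarrow> var i \<in> carrier (poly_ring n)"
  by (simp add: carrier_poly_ring_iff var_def)

lemma var_sq_carrier: "(\<lambda>i. var i ^ 2) ` {1..n} \<subseteq> carrier (poly_ring n)"
proof -
  interpret cring "poly_ring n" by (rule poly_ring_cring)
  have "var i * var i \<in> carrier (poly_ring n)" if "i \<in> {1..n}" for i
    using m_closed[OF var_carrier[OF that] var_carrier[OF that]] by simp
  then show ?thesis by (auto simp: power2_eq_square)
qed

lemma sq_ideal_ideal: "ideal (sq_ideal n) (poly_ring n)"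
proof -
  interpret cring "poly_ring n" by (rule poly_ring_cring)
  show ?thesis unfolding sq_ideal_def by (rule genideal_ideal[OF var_sq_carrier])
qed

end

theory Submission
  imports Defs
begin

text \<open>
  Expand the product of the two representatives over all pairs \<open>(A, B)\<close> of subsets of $[n]$. If
  \<open>A\<close> and \<open>B\<close> are disjoint, then $t^A t^B = t^{A \cup B}$, and sorting these pairs by their union
  gives the convolution; otherwise $t^A t^B$ is divisible by $t_i^2$ for any $i \in A \cap B$.
\<close>

text \<open>The type \<open>rpoly\<close> admits variables of every natural index, and
  \<open>sq_ideal n\<close> absorbs only multipliers from the carrier, so membership in the carrier
  has to be tracked throughout.\<close>

lemma carrier_poly_ring_mult:
  "p \<in> carrier (poly_ring n) \<Longrightarrow> q \<in> carrier (poly_ring n) \<Longrightarrow> p * q \<in> carrier (poly_ring n)"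
  using cring.cring_simprules(5)[OF poly_ring_cring] by simp

lemma carrier_poly_ring_sum:
  "(\<And>x. x \<in> X \<Longrightarrow> h x \<in> carrier (poly_ring n)) \<Longrightarrow> sum h X \<in> carrier (poly_ring n)"
proof (induction X rule: infinite_finite_induct)
  case (insert x X)
  then show ?case
    using cring.cring_simprules(1)[OF poly_ring_cring, of "h x" n "sum h X"] by simp
qed (simp_all add: carrier_poly_ring_iff)

lemma const_carrier: "const c \<in> carrier (poly_ring n)"
  by (simp add: carrier_poly_ring_iff const_def)

lemma tpow_carrier: "S \<subseteq> {1..n} \<Longrightarrow> tpow S \<in> carrier (poly_ring n)"
  unfolding tpow_def
proof (induction S rule: infinite_finite_induct)
  case (insert x S)
  then show ?case
    using carrier_poly_ring_mult[OF var_carrier] by simp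
qed (simp_all add: carrier_poly_ring_iff)

lemma const_sum: "const (sum h X) = (\<Sum>x\<in>X. const (h x))"
  unfolding const_def
  by (induction X rule: infinite_finite_induct) (simp_all add: single_add)

lemma const_mult: "const (a * b) = const a * const b"
  by (simp add: const_def mult_single)

lemma tpow_union_disjoint:
  assumes "finite A" "finite B" "A \<inter> B = {}"
  shows "tpow (A \<union> B) = tpow A * tpow B"
  unfolding tpow_def by (rule prod.union_disjoint[OF assms])

lemma var_sq_in_sq_ideal: "i \<in> {1..n} \<Longrightarrow> var i ^ 2 \<in> sq_ideal n"
  unfolding sq_ideal_def
  using cring.axioms(1)[OF poly_ring_cring] ring.genideal_self[OF _ var_sq_carrier] by blast

lemma sq_ideal_mult:
  "r \<in> sq_ideal n \<Longrightarrow> p \<in> carrier (poly_ring n) \<Longrightarrow> p * r \<in> sq_ideal n"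
  using ideal.I_l_closed[OF sq_ideal_ideal] by simp

lemma sq_ideal_sum:
  "(\<And>x. x \<in> X \<Longrightarrow> h x \<in> sq_ideal n) \<Longrightarrow> sum h X \<in> sq_ideal n"
proof (induction X rule: infinite_finite_induct)
  case (insert x X)
  then show ?case
    using additive_subgroup.a_closed[OF ideal.axioms(1)[OF sq_ideal_ideal], of "h x" n "sum h X"]
    by simp
\<comment> \<open>The remaining cases are empty \<open>X\<close> and infinite \<open>X\<close>; a
  sum over an infinite set is 0 by convention, and an ideal contains 0.\<close>
qed (use additive_subgroup.zero_closed[OF ideal.axioms(1)[OF sq_ideal_ideal]] in simp_all)

lemma tpow_mult_in_sq_ideal:
  assumes A: "A \<subseteq> {1..n}" and B: "B \<subseteq> {1..n}" and "A \<inter> B \<noteq> {}"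
  shows "tpow A * tpow B \<in> sq_ideal n"
proof -
  obtain i where i: "i \<in> A" "i \<in> B" using assms by blast
  have fin: "finite A" "finite B" using A B finite_subset by blast+
  have "tpow A = var i * tpow (A - {i})" "tpow B = var i * tpow (B - {i})"
    unfolding tpow_def using prod.remove[OF fin(1) i(1)] prod.remove[OF fin(2) i(2)] by blast+
  then have "tpow A * tpow B = (tpow (A - {i}) * tpow (B - {i})) * var i ^ 2"
    by (simp add: power2_eq_square mult_ac)
  moreover have "tpow (A - {i}) * tpow (B - {i}) \<in> carrier (poly_ring n)"
    using A B by (intro carrier_poly_ring_mult tpow_carrier) auto
  ultimately show ?thesis
    using sq_ideal_mult[OF var_sq_in_sq_ideal] i A by auto
qed

text \<open>A chosen polynomial in the coset \<open>elt n f\<close>: the computation is done on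
  polynomials and passes to the quotient only at the end.\<close>

definition repr :: "nat \<Rightarrow> (nat set \<Rightarrow> real) \<Rightarrow> rpoly" where
  "repr n f = (\<Sum>S\<in>Pow {1..n}. const (f S) * tpow S)"

lemma repr_carrier: "repr n f \<in> carrier (poly_ring n)"
  unfolding repr_def
  by (intro carrier_poly_ring_sum carrier_poly_ring_mult const_carrier tpow_carrier) auto

text \<open>Choosing \<open>A\<close> inside \<open>S\<close> amounts to splitting \<open>S\<close>
  into a disjoint pair. The summands are left in the form in which they occur in the expanded
  product.\<close>

lemma repr_set_conv:
  "repr n (f \<boxplus> g) =
    (\<Sum>(A, B) \<in> {(A, B). A \<subseteq> {1..n} \<and> B \<subseteq> {1..n} \<and> A \<inter> B = {}}.
      (const (f A) * tpow A) * (const (g B) * tpow B))"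
proof -
  have "repr n (f \<boxplus> g) =
      (\<Sum>S\<in>Pow {1..n}. \<Sum>A\<in>Pow S. const (f A) * const (g (S - A)) * tpow S)"
    by (simp add: repr_def set_conv_def const_sum const_mult sum_distrib_right)
  also have "\<dots> = (\<Sum>(S, A) \<in> Sigma (Pow {1..n}) Pow. const (f A) * const (g (S - A)) * tpow S)"
    by (rule sum.Sigma) (auto intro: finite_subset)
  also have "\<dots> = (\<Sum>(A, B) \<in> {(A, B). A \<subseteq> {1..n} \<and> B \<subseteq> {1..n} \<and> A \<inter> B = {}}.
      (const (f A) * tpow A) * (const (g B) * tpow B))"
  \<comment> \<open>The two maps are mutually inverse because \<open>(A \<union> B) - A = B\<close>
    for disjoint \<open>A\<close> and \<open>B\<close>. Case 5 is the equality of the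
    summands.\<close>
  proof (rule sum.reindex_bij_witness[where i = "\<lambda>(A, B). (A \<union> B, A)"
        and j = "\<lambda>(S, A). (A, S - A)"], goal_cases)
    case (5 x)
    then obtain S A where x: "x = (S, A)" and S: "S \<subseteq> {1..n}" and A: "A \<subseteq> S" by auto
    have "finite S" using S finite_subset by blast
    then have "tpow (A \<union> (S - A)) = tpow A * tpow (S - A)"
      using A by (intro tpow_union_disjoint) (auto intro: finite_subset)
    moreover have "A \<union> (S - A) = S" using A by blast
    ultimately show ?case by (simp add: x mult_ac)
  qed auto
  finally show ?thesis .
qed

text \<open>The error term \<open>r\<close> collects the pairs that intersect. Having it as the left
  summand matches the shape of the elements of a coset.\<close>

lemma repr_mult:
  obtains r where "r \<in> sq_ideal n" "repr n f * repr n g = r + repr n (f \<boxplus> g)"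
proof -
  let ?t = "\<lambda>(A, B). (const (f A) * tpow A) * (const (g B) * tpow B)"
  let ?P = "Pow {1..n} \<times> Pow {1..n}"
  let ?D = "{(A, B). A \<subseteq> {1..n} \<and> B \<subseteq> {1..n} \<and> A \<inter> B = {}}"
  have "repr n f * repr n g = sum ?t ?P"
    by (simp add: repr_def sum_product sum.cartesian_product)
  also have "\<dots> = sum ?t (?P - ?D) + sum ?t ?D"
    by (rule sum.subset_diff) auto
  finally have "repr n f * repr n g = sum ?t (?P - ?D) + repr n (f \<boxplus> g)"
    by (simp add: repr_set_conv)
  moreover have "sum ?t (?P - ?D) \<in> sq_ideal n"
  proof (rule sq_ideal_sum)
    fix x assume "x \<in> ?P - ?D"
    then obtain A B where x: "x = (A, B)" and "A \<subseteq> {1..n}" "B \<subseteq> {1..n}" "A \<inter> B \<noteq> {}"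
      by auto
    \<comment> \<open>Gathering the constants into one multiplier from the carrier reduces the claim
      to \<open>tpow A * tpow B\<close>.\<close>
    then have "(const (f A) * const (g B)) * (tpow A * tpow B) \<in> sq_ideal n"
      by (intro sq_ideal_mult tpow_mult_in_sq_ideal carrier_poly_ring_mult const_carrier)
    then show "?t x \<in> sq_ideal n" by (simp add: x mult_ac)
  qed
  ultimately show ?thesis using that by blast
qed

theorem lemma3p3:
  fixes n :: nat and f g :: "nat set \<Rightarrow> real"
  shows "elt n (f \<boxplus> g) = elt n f \<otimes>\<^bsub>algA n\<^esub> elt n g"
proof -
  interpret ideal "sq_ideal n" "poly_ring n" by (rule sq_ideal_ideal)
  have elt: "elt n h = sq_ideal n +>\<^bsub>poly_ring n\<^esub> repr n h" for h
    by (simp add: elt_def repr_def)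
  obtain r where r: "r \<in> sq_ideal n" "repr n f * repr n g = r + repr n (f \<boxplus> g)"
    by (rule repr_mult)
  then have "repr n f * repr n g \<in> sq_ideal n +>\<^bsub>poly_ring n\<^esub> repr n (f \<boxplus> g)"
    by (auto simp: a_r_coset_def')
  \<comment> \<open>A coset is also the coset of any of its members, here of the product of the
    representatives.\<close>
  then have "elt n (f \<boxplus> g) = sq_ideal n +>\<^bsub>poly_ring n\<^esub> (repr n f * repr n g)"
    unfolding elt by (rule a_repr_independence'[OF _ repr_carrier])
  \<comment> \<open>The product in the quotient is a union of cosets over all pairs of members of
    the factors; \<open>rcoset_mult_add\<close> collapses it to the coset of a single
    product.\<close>
  also have "\<dots> = elt n f \<otimes>\<^bsub>algA n\<^esub> elt n g"
    using rcoset_mult_add[OF repr_carrier repr_carrier, of f g]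
    by (simp add: algA_def FactRing_def elt)
  finally show ?thesis .
qed

end
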